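(* Let $m\ge 2$, let $n_1\le\cdots\le n_m$ be positive integers, and let $G=K_{n_1,\dots,n_m}$ be the complete multipartite graph with vertex partition $V=V_1\sqcup\cdots\sqcup V_m$, $|V_i|=n_i$. Let $t$ be a positive integer and $k=\lfloor t/2\rfloor$. For each $j\in\{1,\dots,m\}$ set $W_j=\bigcup_{i\ne j}V_i$. Then the $t$-path-free complex $\mathrm{PF}_t(G)$ satisfies $$\mathrm{PF}_t(G)=\left(\bigcup_{j=1}^{m}\left(\Delta_{V_j} * (\Delta_{W_j})^{[k-2]}\right)\right)\cup(\Delta_V)^{[t-2]}.$$
   Context: Complete multipartite graph: two vertices of $K_{n_1,\dots,n_m}$ are adjacent if and only if they lie in different parts $V_i$, $V_j$ with $i\neq j$. Path-free complex: $\mathrm{PF}_t(G)$ is the simplicial complex on the vertex set $V(G)$ whose faces are the subsets $F\subseteq V(G)$ such that the induced subgraph $G[F]$ contains no subgraph (not necessarily induced) isomorphic to a path on $t$ vertices. Notation: $\Delta_U$ is the simplex on the vertex set $U$ (all subsets of $U$). The dimension of a face $F$ is $|F|-1$. For a simplicial complex $\Delta$, $\Delta^{[d]}$ denotes its pure $d$-skeleton, i.e. the subcomplex whose facets (maximal faces) are precisely the $d$-dimensional faces of $\Delta$. The empty complex $\{\emptyset\}$, consisting only of the empty set, is the unique $(-1)$-dimensional complex; the void complex has no faces. The join of complexes on disjoint vertex sets is $\Delta_1*\Delta_2=\{F_1\cup F_2: F_1\in\Delta_1,\ F_2\in\Delta_2\}$. Unions are unions of the sets of faces.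
   Formalization: When a simplex has no face of dimension d because d exceeds its dimension, its pure d-skeleton is taken to be the whole simplex rather than the void complex; with the void complex the identity fails, e.g. for K_{1,1} and t=10. *)

theory Defs
  imports "Graph_Theory.Graph_Theory" "HOL-Library.Disjoint_Sets"
begin

text \<open>
  As usual in Graph_Theory, a finite simple graph is a symmetric, loop-free digraph without
  parallel arcs, that is, a model of the locale \<open>graph\<close>.
\<close>

definition complete_multipartite ::
  "('a, 'b) pre_digraph \<Rightarrow> 'i set \<Rightarrow> ('i \<Rightarrow> 'a set) \<Rightarrow> bool" where
  "complete_multipartite G I V \<longleftrightarrow>
     graph G \<and> disjoint_family_on V I \<and> verts G = (\<Union>i\<in>I. V i) \<and>
     arcs_ends G = {(u, v). \<exists>i\<in>I. \<exists>j\<in>I. i \<noteq> j \<and> u \<in> V i \<and> v \<in> V j}"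

definition path_graph :: "nat \<Rightarrow> nat pair_pre_digraph" where
  "path_graph t = \<lparr> pverts = {0..<t},
     parcs = {(i, j). i < t \<and> j < t \<and> (j = Suc i \<or> i = Suc j)} \<rparr>"

text \<open>
  Complexes are represented by their sets of faces. So \<open>{}\<close> is the void complex and
  \<open>{{}}\<close> is the empty complex. The subgraph \<open>H\<close> below need not be induced. It need not
  be assumed symmetric either, since it is isomorphic to the symmetric digraph \<open>path_graph t\<close>.
\<close>

definition path_free_complex :: "nat \<Rightarrow> ('a, 'b) pre_digraph \<Rightarrow> 'a set set" where
  "path_free_complex t G =
     {F. F \<subseteq> verts G \<and>
         \<not> (\<exists>H. subgraph H (G \<restriction> F) \<and> digraph_iso (with_proj (path_graph t)) H)}"

definition full_simplex :: "'a set \<Rightarrow> 'a set set" where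
  "full_simplex U = Pow U"

definition face_dim :: "'a set \<Rightarrow> int" where
  "face_dim F = int (card F) - 1"

definition facets :: "'a set set \<Rightarrow> 'a set set" where
  "facets \<Delta> = {F \<in> \<Delta>. \<forall>H\<in>\<Delta>. F \<subseteq> H \<longrightarrow> F = H}"

text \<open>
  If \<open>\<Delta>\<close> has a face of dimension \<open>d\<close>, the pure \<open>d\<close>-skeleton is the complex generated by the
  \<open>d\<close>-dimensional faces. If \<open>d\<close> exceeds the dimension of \<open>\<Delta>\<close>, we use the customary skeleton
  convention that nothing is cut off, so the result is \<open>\<Delta>\<close> rather than the void complex.
  For \<open>d < -1\<close> there are no faces of dimension \<open>d\<close> and the result is the void complex.
\<close>

definition pure_skeleton :: "'a set set \<Rightarrow> int \<Rightarrow> 'a set set" where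
  "pure_skeleton \<Delta> d =
     (if \<forall>F\<in>\<Delta>. face_dim F < d then \<Delta>
      else {F \<in> \<Delta>. \<exists>H\<in>\<Delta>. F \<subseteq> H \<and> face_dim H = d})"

lemma facets_pure_skeleton:
  assumes "\<And>F. F \<in> \<Delta> \<Longrightarrow> finite F" and "\<exists>F\<in>\<Delta>. face_dim F = d"
  shows "facets (pure_skeleton \<Delta> d) = {F \<in> \<Delta>. face_dim F = d}"
proof -
  have eq: "pure_skeleton \<Delta> d = {F \<in> \<Delta>. \<exists>H\<in>\<Delta>. F \<subseteq> H \<and> face_dim H = d}"
    using assms(2) by (force simp: pure_skeleton_def)
  have max: "F = H" if asm: "F \<in> \<Delta>" "face_dim F = d" "H \<in> pure_skeleton \<Delta> d" "F \<subseteq> H" for F H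
  proof -
    obtain K where "K \<in> \<Delta>" "H \<subseteq> K" "face_dim K = d"
      using asm(3) unfolding eq by blast
    then have "F = K"
      using asm(2,4) assms(1) by (intro card_subset_eq) (auto simp: face_dim_def)
    then show ?thesis using asm(4) \<open>H \<subseteq> K\<close> by blast
  qed
  show ?thesis
  proof (intro equalityI subsetI)
    fix F assume F: "F \<in> facets (pure_skeleton \<Delta> d)"
    then obtain H where H: "H \<in> \<Delta>" "F \<subseteq> H" "face_dim H = d"
      unfolding facets_def eq by blast
    then have "H \<in> pure_skeleton \<Delta> d" unfolding eq by blast
    then have "F = H" using F H(2) unfolding facets_def by blast
    then show "F \<in> {F \<in> \<Delta>. face_dim F = d}" using H by blast
  next
    fix F assume F: "F \<in> {F \<in> \<Delta>. face_dim F = d}"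
    then have "F \<in> pure_skeleton \<Delta> d" unfolding eq by blast
    then show "F \<in> facets (pure_skeleton \<Delta> d)"
      using max F unfolding facets_def by blast
  qed
qed

definition complex_join :: "'a set set \<Rightarrow> 'a set set \<Rightarrow> 'a set set" where
  "complex_join \<Delta>1 \<Delta>2 = {F1 \<union> F2 | F1 F2. F1 \<in> \<Delta>1 \<and> F2 \<in> \<Delta>2}"

end

theory Submission
  imports Defs
begin

text \<open>
  Colour every vertex by the part that contains it. In a complete multipartite graph a path on
  \<open>t\<close> vertices inside \<open>F\<close> is then an injective sequence of length \<open>t\<close> in \<open>F\<close> whose consecutive
  colours differ, so the theorem is a statement about colourings (\<open>proper_sequence_iff\<close>):
  such a sequence exists if and only if \<open>F\<close> has at least \<open>t\<close> vertices and, for every colour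
  \<open>j\<close>, at least \<open>t div 2\<close> vertices of colours other than \<open>j\<close>.

  These conditions are necessary because each of the \<open>t div 2\<close> disjoint pairs of consecutive
  positions of the sequence contains a vertex not coloured \<open>j\<close>. For sufficiency, put
  \<open>h = t - t div 2\<close> and interleave two lists, one of length \<open>h\<close> and one of length \<open>t div 2\<close>. If
  some colour has at least \<open>h\<close> vertices, take \<open>h\<close> of these for the first list and vertices of
  other colours for the second. Otherwise sort \<open>F\<close> by colour and let the lists be the first and
  the second half of an initial segment of length \<open>t\<close>: neighbours in the interleaving have
  distance \<open>h\<close> or \<open>h - 1\<close> in the sorted order, whereas a colour class is an interval with fewer
  than \<open>h\<close> elements.

  Negating both conditions gives the two kinds of faces. The faces with fewer than \<open>t\<close> vertices
  form the skeleton of the full simplex, and those with fewer than \<open>t div 2\<close> vertices outside a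
  part form the join of the simplex on this part with a skeleton of the simplex on the rest,
  since a skeleton of a simplex is cut out by a bound on the dimension
  (\<open>pure_skeleton_full_simplex\<close>).
\<close>

section \<open>Paths as sequences of vertices\<close>

text \<open>
  This replaces isomorphisms of arc-labelled digraphs by sequences of vertices. Since
  the path has no multiple arcs, the arc map of an isomorphism can be rebuilt from the vertex
  map by choosing an arc for each adjacent pair; symmetry of \<open>G\<close> supplies the arcs that run
  backwards along the path.
\<close>

lemma path_subgraph_iff:
  fixes G :: "('a, 'b) pre_digraph"
  assumes "graph G"
  shows "(\<exists>H. subgraph H (G \<restriction> F) \<and> digraph_iso (with_proj (path_graph t)) H) \<longleftrightarrow>
    (\<exists>p. inj_on p {..<t} \<and> p ` {..<t} \<subseteq> F \<and>
      (\<forall>i. Suc i < t \<longrightarrow> (p i, p (Suc i)) \<in> arcs_ends G))"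
    (is "?subgraph \<longleftrightarrow> ?sequence")
proof
  assume ?subgraph
  then obtain H f where sub: "subgraph H (G \<restriction> F)"
    and f: "pre_digraph.digraph_isomorphism (with_proj (path_graph t)) f"
    and H: "H = app_iso f (with_proj (path_graph t))"
    unfolding digraph_iso_def by blast
  define p where "p = iso_verts f"
  have "inj_on p {..<t}"
    using f by (simp add: pre_digraph.digraph_isomorphism_def p_def path_graph_def atLeast0LessThan)
  moreover have "p ` {..<t} \<subseteq> F"
    using subgraphE[OF sub] by (simp add: H p_def path_graph_def atLeast0LessThan)
  moreover have "(p i, p (Suc i)) \<in> arcs_ends G" if i: "Suc i < t" for i
  proof -
    have arc: "(i, Suc i) \<in> arcs (with_proj (path_graph t))"
      using i by (simp add: path_graph_def)
    let ?a = "iso_arcs f (i, Suc i)"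
    have a: "?a \<in> arcs H"
      using arc unfolding H by simp
    then have "?a \<in> arcs G"
      using sub by (auto elim!: subgraphE)
    moreover have "tail H ?a = p i" "head H ?a = p (Suc i)"
      using f arc unfolding pre_digraph.digraph_isomorphism_def H p_def by force+
    moreover have "tail H = tail G" "head H = head G"
      using sub by (auto simp: compatible_def elim!: subgraphE)
    ultimately show ?thesis
      by (auto simp: arcs_ends_conv intro: rev_image_eqI)
  qed
  ultimately show ?sequence by blast
next
  interpret G: graph G by fact
  assume ?sequence
  then obtain p where inj: "inj_on p {..<t}" and p_F: "p ` {..<t} \<subseteq> F"
    and adj: "\<And>i. Suc i < t \<Longrightarrow> (p i, p (Suc i)) \<in> arcs_ends G" by blast
  have ends: "(p i, p j) \<in> arcs_ends G" if "(i, j) \<in> parcs (path_graph t)" for i j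
    using that adj G.graph_symmetric by (auto simp: path_graph_def)
  define arc where "arc e = (SOME a. a \<in> arcs G \<and> arc_to_ends G a = (p (fst e), p (snd e)))" for e
  have arc: "arc e \<in> arcs G" "tail G (arc e) = p (fst e)" "head G (arc e) = p (snd e)"
    if "e \<in> parcs (path_graph t)" for e
  proof -
    have "\<exists>a. a \<in> arcs G \<and> arc_to_ends G a = (p (fst e), p (snd e))"
      using ends[of "fst e" "snd e"] that by (auto simp: arcs_ends_def)
    from someI_ex[OF this]
    show "arc e \<in> arcs G" "tail G (arc e) = p (fst e)" "head G (arc e) = p (snd e)"
      unfolding arc_def[symmetric] by (auto simp: arc_to_ends_def)
  qed
  have bound: "fst e < t" "snd e < t" if "e \<in> parcs (path_graph t)" for e
    using that by (auto simp: path_graph_def)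
  define f where "f = \<lparr>iso_verts = p, iso_arcs = arc, iso_head = head G, iso_tail = tail G\<rparr>"
  interpret P: wf_digraph "with_proj (path_graph t)"
    by unfold_locales (auto simp: path_graph_def)
  have "inj_on arc (parcs (path_graph t))"
  proof (rule inj_onI)
    fix d e assume "d \<in> parcs (path_graph t)" "e \<in> parcs (path_graph t)" "arc d = arc e"
    then show "d = e"
      using arc(2,3)[of d] arc(2,3)[of e] bound[of d] bound[of e] inj_onD[OF inj]
      by (auto intro!: prod_eqI)
  qed
  then have f: "pre_digraph.digraph_isomorphism (with_proj (path_graph t)) f"
    using inj arc P.wf_digraph
    by (simp add: pre_digraph.digraph_isomorphism_def f_def)
      (simp add: path_graph_def atLeast0LessThan)
  let ?H = "app_iso f (with_proj (path_graph t))"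
  have "subgraph ?H (G \<restriction> F)"
  proof (rule subgraphI)
    show "verts ?H \<subseteq> verts (G \<restriction> F)"
      using p_F by (simp add: f_def path_graph_def atLeast0LessThan)
    show "arcs ?H \<subseteq> arcs (G \<restriction> F)"
      using arc p_F bound by (fastforce simp: f_def)
    show "compatible (G \<restriction> F) ?H"
      by (simp add: compatible_def f_def)
    show "wf_digraph ?H"
      using f by (rule P.wf_digraphI_app_iso)
    show "wf_digraph (G \<restriction> F)"
      by (rule G.wellformed_induce_subgraph)
  qed
  then show ?subgraph
    using f unfolding digraph_iso_def by blast
qed

section \<open>Sequences with distinct consecutive colours\<close>

text \<open>
  One of the positions \<open>2 * i\<close> and \<open>2 * i + 1\<close> avoids the colour \<open>j\<close>, and the pairs for different
  \<open>i\<close> are disjoint.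
\<close>

lemma card_other_colours_ge:
  fixes p :: "nat \<Rightarrow> 'a" and c :: "'a \<Rightarrow> 'c"
  assumes "finite F" and inj: "inj_on p {..<t}" and "p ` {..<t} \<subseteq> F"
    and proper: "\<And>i. Suc i < t \<Longrightarrow> c (p i) \<noteq> c (p (Suc i))"
  shows "t div 2 \<le> card {v \<in> F. c v \<noteq> j}"
proof -
  \<comment> \<open>Dividing by 2 recovers \<open>i\<close> from the selected position, which gives injectivity.\<close>
  define s where "s i = (if c (p (2 * i)) = j then Suc (2 * i) else 2 * i)" for i
  have s_less: "s i < t" and s_div: "s i div 2 = i" and s_col: "c (p (s i)) \<noteq> j"
    if "i < t div 2" for i
  proof -
    have "Suc (2 * i) < t" using that by linarith
    then show "s i < t" "s i div 2 = i" "c (p (s i)) \<noteq> j"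
      using proper[of "2 * i"] by (auto simp: s_def)
  qed
  have "inj_on (p \<circ> s) {..<t div 2}"
    using s_less s_div inj_onD[OF inj] by (intro inj_onI) (metis comp_apply lessThan_iff)
  moreover have "(p \<circ> s) ` {..<t div 2} \<subseteq> {v \<in> F. c v \<noteq> j}"
    using s_less s_col assms(3) by fastforce
  ultimately show ?thesis
    using card_inj_on_le[of "p \<circ> s" "{..<t div 2}" "{v \<in> F. c v \<noteq> j}"] \<open>finite F\<close> by simp
qed

text \<open>
  The order \<open>0, h, 1, h + 1, 2, \<dots>\<close> of the positions brings together only positions \<open>a\<close> in the
  first half and \<open>b\<close> in the second half with \<open>b - a = h\<close> or \<open>b - a = h - 1\<close>. The hypothesis
  \<open>far\<close> covers these pairs, and it holds both for two halves without a common colour and for a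
  sorted sequence with small colour classes. The first half takes the extra position if \<open>t\<close> is
  odd, so that the interleaving both starts and ends in it.
\<close>

lemma interleave_halves:
  fixes y :: "nat \<Rightarrow> 'a" and c :: "'a \<Rightarrow> 'c"
  defines "h \<equiv> \<lambda>t. t - t div 2"
  assumes inj: "inj_on y {..<t}"
    and far: "\<And>a b. a < h t \<Longrightarrow> h t \<le> b \<Longrightarrow> b < t \<Longrightarrow> h t \<le> Suc (b - a) \<Longrightarrow> c (y a) \<noteq> c (y b)"
  shows "\<exists>p. inj_on p {..<t} \<and> p ` {..<t} \<subseteq> y ` {..<t} \<and>
    (\<forall>i. Suc i < t \<longrightarrow> c (p i) \<noteq> c (p (Suc i)))"
proof -
  define s where "s i = (if even i then i div 2 else h t + i div 2)" for i
  have s_less: "s i < t" if "i < t" for i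
    using that by (auto simp: s_def h_def elim!: evenE oddE)
  have even_half: "i div 2 < h t" if "i < t" "even i" for i
    using that by (auto simp: h_def elim!: evenE)
  have "inj_on s {..<t}"
  proof (rule inj_onI)
    fix i j assume "i \<in> {..<t}" "j \<in> {..<t}" "s i = s j"
    then have "even i = even j" "i div 2 = j div 2"
      using even_half[of i] even_half[of j] by (auto simp: s_def split: if_splits)
    then show "i = j"
      by (metis even_two_times_div_two odd_two_times_div_two_succ)
  qed
  then have "inj_on (y \<circ> s) {..<t}"
    using s_less inj by (intro comp_inj_on) (auto intro: inj_on_subset)
  moreover have "(y \<circ> s) ` {..<t} \<subseteq> y ` {..<t}"
    using s_less by auto
  moreover have "c ((y \<circ> s) i) \<noteq> c ((y \<circ> s) (Suc i))" if "Suc i < t" for i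
  proof (cases "even i")
    case True
    then show ?thesis
      using far[of "i div 2" "h t + i div 2"] that even_half[of i] s_less[of "Suc i"]
      by (simp add: s_def)
  next
    case False
    then show ?thesis
      using far[of "Suc (i div 2)" "h t + i div 2"] that even_half[of "Suc i"] s_less[of i]
      by (auto simp: s_def)
  qed
  ultimately show ?thesis by blast
qed

lemma sorted_enumeration:
  fixes c :: "'a \<Rightarrow> 'c::linorder"
  assumes "finite F" "t \<le> card F"
  shows "\<exists>y. inj_on y {..<t} \<and> y ` {..<t} \<subseteq> F \<and>
    (\<forall>a b. a \<le> b \<longrightarrow> b < t \<longrightarrow> c (y a) \<le> c (y b))"
proof -
  obtain xs where xs: "set xs = F" "distinct xs"
    using finite_distinct_list[OF \<open>finite F\<close>] by blast
  let ?ys = "sort_key c xs"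
  have len: "t \<le> length ?ys"
    using xs assms(2) distinct_card by fastforce
  have "inj_on ((!) ?ys) {..<t}"
    using xs len by (intro inj_on_nth) auto
  moreover have "(!) ?ys ` {..<t} \<subseteq> F"
    using len xs nth_mem[of _ ?ys] by auto
  moreover have "c (?ys ! a) \<le> c (?ys ! b)" if "a \<le> b" "b < t" for a b
    using sorted_nth_mono[OF sorted_sort_key[of c xs], of a b] that len by simp
  ultimately show ?thesis by blast
qed

text \<open>
  A colour with at least \<open>t - t div 2\<close> vertices can occupy all even positions, which separates its
  vertices; without such a colour the sorted order works, because equal colours are then close
  together there.
\<close>

lemma proper_sequence_exists:
  fixes c :: "'a \<Rightarrow> 'c::linorder"
  assumes "finite F" "t \<le> card F" and others: "\<And>j. t div 2 \<le> card {v \<in> F. c v \<noteq> j}"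
  shows "\<exists>p. inj_on p {..<t} \<and> p ` {..<t} \<subseteq> F \<and>
    (\<forall>i. Suc i < t \<longrightarrow> c (p i) \<noteq> c (p (Suc i)))"
proof -
  let ?h = "t - t div 2"
  have "\<exists>y. inj_on y {..<t} \<and> y ` {..<t} \<subseteq> F \<and>
    (\<forall>a b. a < ?h \<longrightarrow> ?h \<le> b \<longrightarrow> b < t \<longrightarrow> ?h \<le> Suc (b - a) \<longrightarrow> c (y a) \<noteq> c (y b))"
  proof (cases "\<exists>j. ?h \<le> card {v \<in> F. c v = j}")
    case True
    then obtain j where "?h \<le> card {v \<in> F. c v = j}" ..
    then obtain A where A: "A \<subseteq> {v \<in> F. c v = j}" "card A = ?h" "finite A"
      by (rule obtain_subset_with_card_n)
    obtain B where B: "B \<subseteq> {v \<in> F. c v \<noteq> j}" "card B = t div 2" "finite B"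
      using others[of j] by (rule obtain_subset_with_card_n)
    obtain as where as: "set as = A" "distinct as"
      using finite_distinct_list[OF A(3)] by blast
    obtain bs where bs: "set bs = B" "distinct bs"
      using finite_distinct_list[OF B(3)] by blast
    have len: "length as = ?h" "length bs = t div 2"
      using as bs A(2) B(2) distinct_card by fastforce+
    let ?y = "(!) (as @ bs)"
    have "inj_on ?y {..<t}"
      using as bs A(1) B(1) len by (intro inj_on_nth) auto
    moreover have "?y ` {..<t} \<subseteq> F"
    proof -
      have "?y ` {..<t} \<subseteq> set (as @ bs)"
        using len by (auto simp del: set_append intro!: nth_mem)
      then show ?thesis using as bs A(1) B(1) by auto
    qed
    moreover have "c (?y a) \<noteq> c (?y b)" if "a < ?h" "?h \<le> b" "b < t" for a b
    proof -
      have "b - ?h < t div 2" using that by linarith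
      then have "?y a \<in> A" "?y b \<in> B"
        using that len as(1) bs(1) nth_mem[of a as] nth_mem[of "b - ?h" bs]
        by (simp_all add: nth_append)
      then have "c (?y a) = j" "c (?y b) \<noteq> j" using A(1) B(1) by blast+
      then show ?thesis by metis
    qed
    then have "\<forall>a b. a < ?h \<longrightarrow> ?h \<le> b \<longrightarrow> b < t \<longrightarrow> ?h \<le> Suc (b - a) \<longrightarrow> c (?y a) \<noteq> c (?y b)"
      by blast
    ultimately show ?thesis by (intro exI[of _ ?y] conjI)
  next
    case False
    obtain y where y: "inj_on y {..<t}" "y ` {..<t} \<subseteq> F"
      and mono: "\<And>a b. a \<le> b \<Longrightarrow> b < t \<Longrightarrow> c (y a) \<le> c (y b)"
      using sorted_enumeration[OF assms(1,2)] by blast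
    have "c (y a) \<noteq> c (y b)" if "a < ?h" "?h \<le> b" "b < t" "?h \<le> Suc (b - a)" for a b
    proof
      assume eq: "c (y a) = c (y b)"
      \<comment> \<open>By monotonicity the whole interval between them has this colour, which is too many.\<close>
      have "y i \<in> {v \<in> F. c v = c (y a)}" if "i \<in> {a..b}" for i
      proof -
        have "c (y i) \<le> c (y a)" using mono[of i b] that \<open>b < t\<close> unfolding eq by simp
        moreover have "c (y a) \<le> c (y i)" using mono[of a i] that \<open>b < t\<close> by simp
        moreover have "y i \<in> F" using y(2) that \<open>b < t\<close> by auto
        ultimately show ?thesis by simp
      qed
      then have sub: "y ` {a..b} \<subseteq> {v \<in> F. c v = c (y a)}"
        by (rule image_subsetI)
      have "Suc (b - a) = card (y ` {a..b})"
        using y(1) \<open>b < t\<close> \<open>a < ?h\<close> \<open>?h \<le> b\<close>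
        by (subst card_image) (auto intro: inj_on_subset)
      also have "\<dots> \<le> card {v \<in> F. c v = c (y a)}"
        using sub \<open>finite F\<close> by (intro card_mono) auto
      finally show False
        using False \<open>?h \<le> Suc (b - a)\<close> le_trans by blast
    qed
    with y show ?thesis by (intro exI[of _ y] conjI allI impI)
  qed
  then obtain y where inj: "inj_on y {..<t}" and y_F: "y ` {..<t} \<subseteq> F"
    and far: "\<forall>a b. a < ?h \<longrightarrow> ?h \<le> b \<longrightarrow> b < t \<longrightarrow> ?h \<le> Suc (b - a) \<longrightarrow> c (y a) \<noteq> c (y b)"
    by (elim exE conjE)
  have "\<exists>p. inj_on p {..<t} \<and> p ` {..<t} \<subseteq> y ` {..<t} \<and>
      (\<forall>i. Suc i < t \<longrightarrow> c (p i) \<noteq> c (p (Suc i)))"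
    using far by (intro interleave_halves[OF inj]) simp
  then obtain p where "inj_on p {..<t}" and p_y: "p ` {..<t} \<subseteq> y ` {..<t}"
    and "\<forall>i. Suc i < t \<longrightarrow> c (p i) \<noteq> c (p (Suc i))"
    by (elim exE conjE)
  with order_trans[OF p_y y_F] show ?thesis
    by (intro exI[of _ p] conjI)
qed

lemma proper_sequence_iff:
  fixes c :: "'a \<Rightarrow> 'c::linorder"
  assumes "finite F"
  shows "(\<exists>p. inj_on p {..<t} \<and> p ` {..<t} \<subseteq> F \<and>
      (\<forall>i. Suc i < t \<longrightarrow> c (p i) \<noteq> c (p (Suc i)))) \<longleftrightarrow>
    t \<le> card F \<and> (\<forall>j. t div 2 \<le> card {v \<in> F. c v \<noteq> j})"
    (is "(\<exists>p. ?proper p) \<longleftrightarrow> _")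
proof
  assume "\<exists>p. ?proper p"
  then obtain p where p: "?proper p" ..
  then have "t \<le> card F"
    using card_inj_on_le[of p "{..<t}" F] assms by simp
  moreover have "t div 2 \<le> card {v \<in> F. c v \<noteq> j}" for j
    using card_other_colours_ge[of F p t c j] p assms by blast
  ultimately show "t \<le> card F \<and> (\<forall>j. t div 2 \<le> card {v \<in> F. c v \<noteq> j})" by blast
next
  assume "t \<le> card F \<and> (\<forall>j. t div 2 \<le> card {v \<in> F. c v \<noteq> j})"
  then show "\<exists>p. ?proper p"
    by (intro proper_sequence_exists[OF assms]) auto
qed

section \<open>Faces of path-free complexes of complete multipartite graphs\<close>

text \<open>
  The criterion for sequences quantifies over all colours, but a colour outside \<open>I\<close> adds nothing:
  all of \<open>F\<close> avoids it, so it fails the criterion only if \<open>card F < t div 2\<close>, which implies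
  \<open>card F < t\<close>.
\<close>

lemma path_free_complex_complete_multipartite:
  fixes V :: "'i::linorder \<Rightarrow> 'a set"
  assumes G: "complete_multipartite G I V"
  shows "path_free_complex t G =
    {F. F \<subseteq> verts G \<and> (card F < t \<or> (\<exists>j\<in>I. card (F - V j) < t div 2))}"
proof -
  have graph: "graph G" and disj: "disjoint_family_on V I"
    and verts: "verts G = (\<Union>i\<in>I. V i)"
    and ends: "arcs_ends G = {(u, v). \<exists>i\<in>I. \<exists>j\<in>I. i \<noteq> j \<and> u \<in> V i \<and> v \<in> V j}"
    using G by (auto simp: complete_multipartite_def)
  interpret graph G by (rule graph)
  define c where "c v = (THE i. i \<in> I \<and> v \<in> V i)" for v
  have c_eq: "c v = i" if "i \<in> I" "v \<in> V i" for v i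
    unfolding c_def using that disj by (auto simp: disjoint_family_on_def intro!: the_equality)
  have c: "c v \<in> I" "v \<in> V (c v)" if "v \<in> verts G" for v
    using that c_eq unfolding verts by auto
  have adj: "(u, v) \<in> arcs_ends G \<longleftrightarrow> c u \<noteq> c v" if "u \<in> verts G" "v \<in> verts G" for u v
    using c[OF that(1)] c[OF that(2)] c_eq unfolding ends by blast
  have "F \<in> path_free_complex t G \<longleftrightarrow> card F < t \<or> (\<exists>j\<in>I. card (F - V j) < t div 2)"
    if F: "F \<subseteq> verts G" for F
  proof -
    have "finite F" using F finite_verts finite_subset by blast
    have off: "{v \<in> F. c v \<noteq> j} = F - V j" if "j \<in> I" for j
      using that c c_eq F by blast
    have unused: "{v \<in> F. c v \<noteq> j} = F" if "j \<notin> I" for j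
      using that c(1) F by blast
    have "F \<in> path_free_complex t G \<longleftrightarrow>
      \<not> (\<exists>p. inj_on p {..<t} \<and> p ` {..<t} \<subseteq> F \<and>
          (\<forall>i. Suc i < t \<longrightarrow> (p i, p (Suc i)) \<in> arcs_ends G))"
      using F path_subgraph_iff[OF graph] by (simp add: path_free_complex_def)
    also have "\<dots> \<longleftrightarrow> \<not> (\<exists>p. inj_on p {..<t} \<and> p ` {..<t} \<subseteq> F \<and>
          (\<forall>i. Suc i < t \<longrightarrow> c (p i) \<noteq> c (p (Suc i))))"
    proof -
      have "(p i, p (Suc i)) \<in> arcs_ends G \<longleftrightarrow> c (p i) \<noteq> c (p (Suc i))"
        if "p ` {..<t} \<subseteq> F" "Suc i < t" for p and i :: nat
        using that F by (intro adj) (auto dest: Suc_lessD)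
      then show ?thesis by blast
    qed
    also have "\<dots> \<longleftrightarrow> card F < t \<or> (\<exists>j. card {v \<in> F. c v \<noteq> j} < t div 2)"
      unfolding proper_sequence_iff[OF \<open>finite F\<close>] by (auto simp: not_le)
    also have "\<dots> \<longleftrightarrow> card F < t \<or> (\<exists>j\<in>I. card (F - V j) < t div 2)"
    proof -
      have "card F < t" if "j \<notin> I" "card {v \<in> F. c v \<noteq> j} < t div 2" for j
        using that unused[of j] by simp
      then show ?thesis using off by metis
    qed
    finally show ?thesis .
  qed
  then show ?thesis by (auto simp: path_free_complex_def)
qed

section \<open>Skeleta of simplices and their joins\<close>

text \<open>
  If \<open>U\<close> is large enough, any set of dimension at most \<open>d\<close> extends to one of dimension exactly
  \<open>d\<close> inside \<open>U\<close>; if not, every subset of \<open>U\<close> satisfies the bound. So the case distinction in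
  the definition disappears, also for \<open>d < -1\<close>, where both sides are void.
\<close>

lemma pure_skeleton_full_simplex:
  assumes "finite U"
  shows "pure_skeleton (full_simplex U) d = {F. F \<subseteq> U \<and> face_dim F \<le> d}"
proof (cases "\<forall>F\<in>full_simplex U. face_dim F < d")
  case True
  have "face_dim F \<le> d" if "F \<subseteq> U" for F
    using bspec[OF True, of F] that by (simp add: full_simplex_def)
  then have "full_simplex U = {F. F \<subseteq> U \<and> face_dim F \<le> d}"
    unfolding full_simplex_def by blast
  then show ?thesis
    unfolding pure_skeleton_def if_P[OF True] .
next
  case False
  then obtain K where "K \<subseteq> U" "d \<le> face_dim K"
    unfolding full_simplex_def not_less[symmetric] by blast
  then have large: "d \<le> face_dim U"
    using card_mono[OF assms, of K] by (simp add: face_dim_def)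
  have extend: "\<exists>H. H \<subseteq> U \<and> F \<subseteq> H \<and> face_dim H = d" if F: "F \<subseteq> U" "face_dim F \<le> d" for F
  proof -
    have size: "card F \<le> nat (d + 1)" "nat (d + 1) \<le> card U" "0 \<le> d + 1"
      using F(2) large unfolding face_dim_def by linarith+
    then obtain H where H: "F \<subseteq> H" "H \<subseteq> U" "card H = nat (d + 1)"
      using exists_subset_between[OF size(1,2) F(1) assms] by (elim exE conjE)
    then have "face_dim H = d" using size(3) by (simp add: face_dim_def)
    then show ?thesis using H(1,2) by (intro exI[of _ H] conjI)
  qed
  have mono: "face_dim F \<le> face_dim H" if "F \<subseteq> H" "H \<subseteq> U" for F H
    using card_mono[OF finite_subset[OF that(2) assms] that(1)] by (simp add: face_dim_def)
  have "pure_skeleton (full_simplex U) d =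
      {F. F \<subseteq> U \<and> (\<exists>H. H \<subseteq> U \<and> F \<subseteq> H \<and> face_dim H = d)}"
    unfolding pure_skeleton_def if_not_P[OF False] unfolding full_simplex_def by blast
  also have "\<dots> = {F. F \<subseteq> U \<and> face_dim F \<le> d}"
  proof (intro Collect_cong conj_cong refl iffI)
    fix F assume "\<exists>H. H \<subseteq> U \<and> F \<subseteq> H \<and> face_dim H = d"
    then show "face_dim F \<le> d" using mono by metis
  next
    fix F assume "F \<subseteq> U" "face_dim F \<le> d"
    then show "\<exists>H. H \<subseteq> U \<and> F \<subseteq> H \<and> face_dim H = d" by (rule extend)
  qed
  finally show ?thesis .
qed

lemma complex_join_simplex_skeleton:
  assumes "finite W" "A \<inter> W = {}"
  shows "complex_join (full_simplex A) (pure_skeleton (full_simplex W) d) =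
    {F. F \<subseteq> A \<union> W \<and> face_dim (F - A) \<le> d}"
proof (intro equalityI subsetI)
  fix F assume "F \<in> complex_join (full_simplex A) (pure_skeleton (full_simplex W) d)"
  then obtain F1 F2 where "F = F1 \<union> F2" "F1 \<in> full_simplex A"
    "F2 \<in> pure_skeleton (full_simplex W) d"
    unfolding complex_join_def by (elim CollectE exE conjE)
  then have F: "F = F1 \<union> F2" "F1 \<subseteq> A" "F2 \<subseteq> W" "face_dim F2 \<le> d"
    unfolding pure_skeleton_full_simplex[OF assms(1)] by (simp_all add: full_simplex_def)
  have "F - A = F2" using F(1-3) assms(2) by blast
  moreover have "F \<subseteq> A \<union> W" using F(1-3) by blast
  ultimately show "F \<in> {F. F \<subseteq> A \<union> W \<and> face_dim (F - A) \<le> d}" using F(4) by simp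
next
  fix F assume F: "F \<in> {F. F \<subseteq> A \<union> W \<and> face_dim (F - A) \<le> d}"
  have "F \<inter> A \<in> full_simplex A"
    by (simp add: full_simplex_def)
  moreover have "F - A \<in> pure_skeleton (full_simplex W) d"
    using F unfolding pure_skeleton_full_simplex[OF assms(1)] by blast
  moreover have "F = (F \<inter> A) \<union> (F - A)" by blast
  ultimately have "\<exists>F1 F2. F = F1 \<union> F2 \<and> F1 \<in> full_simplex A \<and>
      F2 \<in> pure_skeleton (full_simplex W) d"
    by (intro exI[of _ "F \<inter> A"] exI[of _ "F - A"] conjI)
  then show "F \<in> complex_join (full_simplex A) (pure_skeleton (full_simplex W) d)"
    unfolding complex_join_def by (rule CollectI)
qed

section \<open>The decomposition of the path-free complex\<close>

theorem lemma3p5: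
  fixes G :: "('a, 'b) pre_digraph"
    and m t k :: nat
    and n :: "nat \<Rightarrow> nat"
    and V W :: "nat \<Rightarrow> 'a set"
  assumes "m \<ge> 2"
    and "\<And>i. i \<in> {1..m} \<Longrightarrow> n i > 0"
    and "mono_on {1..m} n"
    and "complete_multipartite G {1..m} V"
    and "\<And>i. i \<in> {1..m} \<Longrightarrow> card (V i) = n i"
    and "t > 0"
    and "k = t div 2"
    and "\<And>j. j \<in> {1..m} \<Longrightarrow> W j = (\<Union>i\<in>{1..m} - {j}. V i)"
  shows "path_free_complex t G =
    (\<Union>j\<in>{1..m}. complex_join (full_simplex (V j))
                    (pure_skeleton (full_simplex (W j)) (int k - 2)))
    \<union> pure_skeleton (full_simplex (\<Union>i\<in>{1..m}. V i)) (int t - 2)"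
proof -
  have graph: "graph G" and disj: "disjoint_family_on V {1..m}"
    and verts: "verts G = (\<Union>i\<in>{1..m}. V i)"
    using assms(4) unfolding complete_multipartite_def by blast+
  interpret graph G by (rule graph)
  have fin: "finite (\<Union>i\<in>{1..m}. V i)"
    using finite_verts unfolding verts .
  have join: "complex_join (full_simplex (V j)) (pure_skeleton (full_simplex (W j)) (int k - 2)) =
      {F. F \<subseteq> verts G \<and> card (F - V j) < t div 2}" if j: "j \<in> {1..m}" for j
  proof -
    have "finite (W j)"
      unfolding assms(8)[OF j] by (rule finite_subset[OF _ fin]) blast
    moreover have "V j \<inter> W j = {}"
      using disj j unfolding assms(8)[OF j] disjoint_family_on_def by blast
    moreover have "V j \<union> W j = verts G"
      using j unfolding assms(8)[OF j] verts by blast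
    moreover have "face_dim (F - V j) \<le> int k - 2 \<longleftrightarrow> card (F - V j) < t div 2" for F
      unfolding face_dim_def assms(7) by linarith
    ultimately show ?thesis
      by (simp only: complex_join_simplex_skeleton)
  qed
  have skeleton: "pure_skeleton (full_simplex (\<Union>i\<in>{1..m}. V i)) (int t - 2) =
      {F. F \<subseteq> verts G \<and> card F < t}"
  proof -
    have "face_dim F \<le> int t - 2 \<longleftrightarrow> card F < t" for F :: "'a set"
      unfolding face_dim_def by linarith
    then show ?thesis
      by (simp only: pure_skeleton_full_simplex[OF fin] verts)
  qed
  have faces: "path_free_complex t G =
      {F. F \<subseteq> verts G \<and> (card F < t \<or> (\<exists>j\<in>{1..m}. card (F - V j) < t div 2))}"
    by (rule path_free_complex_complete_multipartite[OF assms(4)])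
  have joins: "(\<Union>j\<in>{1..m}. complex_join (full_simplex (V j))
        (pure_skeleton (full_simplex (W j)) (int k - 2))) =
      (\<Union>j\<in>{1..m}. {F. F \<subseteq> verts G \<and> card (F - V j) < t div 2})"
    by (rule SUP_cong[OF refl join])
  show ?thesis
    unfolding faces joins skeleton by blast
qed

end
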